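(* For integers $n,k,i,j\geq 0$, let $A_{i,j}(n,k)$ be the number of alternative tableaux of length $n$ with exactly $k$ rows, $i$ free rows and $j$ free columns. Let $$A(z,u,x,y)=\sum_{n,k,i,j\geq 0}A_{i,j}(n,k)\,x^iy^ju^k\frac{z^n}{n!}.$$ Then $$A(z,u,x,y)=\exp\left(zy(1-u)+(x+y)\ln\left(\frac{1-u}{1-u\exp(z(1-u))}\right)\right).$$
   Context: A shape of length $n$ is a Ferrers diagram in English notation (possibly with empty rows or columns), determined by its south-east border, a path of $n$ unit south/west steps from the top-right to the bottom-left corner. South steps correspond to rows and west steps to columns, so the number of rows plus the number of columns equals $n$. An alternative tableau is a shape with a partial filling of cells by left arrows and up arrows such that every cell to the left of a left arrow in its row, and every cell above an up arrow in its column, is empty. Its length is that of its shape. A free row is a row with no left arrow; a free column is a column with no up arrow. *)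

theory Defs
  imports "HOL-Computational_Algebra.Computational_Algebra"
begin

text \<open>
  A shape of length \<open>n\<close> is given by its south-east border, read from the top-right to the
  bottom-left corner, as a list of \<open>n\<close> steps.  Rows and columns are named by the positions in this
  list of their south, respectively west, step.  The row named \<open>p\<close> and the column named \<open>q\<close>
  intersect in a cell iff \<open>p < q\<close>.  Among rows, smaller names are further up; among columns,
  larger names are further to the left.  The empty rows and columns of the shape are those
  without cells.
\<close>

datatype step = South | West

definition rows :: "step list \<Rightarrow> nat set" where
  "rows s = {p. p < length s \<and> s ! p = South}"

definition columns :: "step list \<Rightarrow> nat set" where
  "columns s = {q. q < length s \<and> s ! q = West}"

definition cells :: "step list \<Rightarrow> (nat \<times> nat) set" where
  "cells s = {(p, q). p \<in> rows s \<and> q \<in> columns s \<and> p < q}"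

datatype arrow = Left_Arrow | Up_Arrow

definition alternative_tableau :: "step list \<Rightarrow> (nat \<times> nat \<Rightarrow> arrow option) \<Rightarrow> bool" where
  "alternative_tableau s T \<longleftrightarrow>
     dom T \<subseteq> cells s \<and>
     (\<forall>p q q'. T (p, q) = Some Left_Arrow \<and> (p, q') \<in> cells s \<and> q < q' \<longrightarrow> T (p, q') = None) \<and>
     (\<forall>p p' q. T (p, q) = Some Up_Arrow \<and> (p', q) \<in> cells s \<and> p' < p \<longrightarrow> T (p', q) = None)"

definition free_rows :: "step list \<Rightarrow> (nat \<times> nat \<Rightarrow> arrow option) \<Rightarrow> nat set" where
  "free_rows s T = {p \<in> rows s. \<forall>q. T (p, q) \<noteq> Some Left_Arrow}"

definition free_columns :: "step list \<Rightarrow> (nat \<times> nat \<Rightarrow> arrow option) \<Rightarrow> nat set" where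
  "free_columns s T = {q \<in> columns s. \<forall>p. T (p, q) \<noteq> Some Up_Arrow}"

definition tableaux :: "nat \<Rightarrow> nat \<Rightarrow> nat \<Rightarrow> nat \<Rightarrow> (step list \<times> (nat \<times> nat \<Rightarrow> arrow option)) set" where
  "tableaux i j n k =
     {(s, T). length s = n \<and> alternative_tableau s T \<and> card (rows s) = k \<and>
              card (free_rows s T) = i \<and> card (free_columns s T) = j}"

definition tableaux_count :: "nat \<Rightarrow> nat \<Rightarrow> nat \<Rightarrow> nat \<Rightarrow> nat" where
  "tableaux_count i j n k = card (tableaux i j n k)"

lemma finite_tableaux: "finite (tableaux i j n k)"
proof -
  have UNIV_step: "(UNIV :: step set) = {South, West}"
    using step.exhaust by auto
  have UNIV_arrow: "(UNIV :: arrow set) = {Left_Arrow, Up_Arrow}"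
    using arrow.exhaust by auto
  have shapes: "finite {s :: step list. length s = n}"
    using finite_lists_length_eq[of "UNIV :: step set" n]
    by (simp add: UNIV_step del: subset_insert_iff) (simp flip: UNIV_step)
  have cells: "finite (cells s)" for s
    by (rule finite_subset[of _ "{..<length s} \<times> {..<length s}"])
      (auto simp: cells_def rows_def columns_def)
  have "finite {T :: nat \<times> nat \<Rightarrow> arrow option. dom T \<subseteq> cells s}" for s
  proof -
    have "{T :: nat \<times> nat \<Rightarrow> arrow option. dom T \<subseteq> cells s}
        = (\<Union>D \<in> Pow (cells s). {T. dom T = D \<and> ran T \<subseteq> UNIV})"
      by auto
    then show ?thesis
      using cells[of s] by (auto intro!: finite_set_of_finite_maps finite_subset[of _ "cells s"]
          simp: UNIV_arrow simp del: subset_UNIV)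
  qed
  then have "finite (SIGMA s : {s. length s = n}. {T :: nat \<times> nat \<Rightarrow> arrow option. dom T \<subseteq> cells s})"
    using shapes by blast
  then show ?thesis
    by (rule rev_finite_subset) (auto simp: tableaux_def alternative_tableau_def)
qed

lemma tableaux_count_eq_0:
  assumes "\<not> (k \<le> n \<and> i \<le> n \<and> j \<le> n)"
  shows "tableaux_count i j n k = 0"
proof -
  have bound: "card X \<le> n" if "X \<subseteq> {..<n}" for X
    using card_mono[OF _ that] by simp
  have "card (rows s) \<le> n" "card (free_rows s T) \<le> n" "card (free_columns s T) \<le> n"
    if "length s = n" for s T
    using that
    by (simp_all add: bound rows_def columns_def free_rows_def free_columns_def subset_iff)
  then have "tableaux i j n k = {}"
    using assms by (auto simp: tableaux_def)
  then show ?thesis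
    by (simp add: tableaux_count_def)
qed

text \<open>
  The coefficient of \<open>z\<^sup>n\<close> in the generating function is a polynomial in \<open>x\<close>, \<open>y\<close> and \<open>u\<close> over the
  rationals, and the closed form needs the inverse of \<open>1 - u\<close>.  So the identity is one of formal
  power series in \<open>z\<close> over the field of rational functions in the indeterminates \<open>x\<close>, \<open>y\<close>, \<open>u\<close>.
\<close>

type_synonym ratfun = "rat poly poly poly fract"

definition x_var :: ratfun where "x_var = to_fract [:[:[:0, 1:]:]:]"

definition y_var :: ratfun where "y_var = to_fract [:[:0, 1:]:]"

definition u_var :: ratfun where "u_var = to_fract [:0, 1:]"

text \<open>By \<open>tableaux_count_eq_0\<close>, the bounds on \<open>k\<close>, \<open>i\<close> and \<open>j\<close> only omit zero summands.\<close>

definition tableaux_gf :: "ratfun fps" where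
  "tableaux_gf = Abs_fps (\<lambda>n.
     (\<Sum>k\<le>n. \<Sum>i\<le>n. \<Sum>j\<le>n.
        of_nat (tableaux_count i j n k) * x_var ^ i * y_var ^ j * u_var ^ k) / fact n)"

text \<open>
  Exponential of a series with constant term \<open>0\<close> and logarithm of a series with constant term \<open>1\<close>;
  the library's \<open>fps_ln 1\<close> is the series of \<open>ln (1 + X)\<close>.
\<close>

definition exp_fps :: "'a :: field_char_0 fps \<Rightarrow> 'a fps" where
  "exp_fps F = fps_exp 1 oo F"

definition ln_fps :: "'a :: field_char_0 fps \<Rightarrow> 'a fps" where
  "ln_fps F = fps_ln 1 oo (F - 1)"

lemma u_var_neq_1: "u_var \<noteq> 1"
proof -
  have "to_fract [:0, 1 :: rat poly poly:] \<noteq> to_fract 1"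
    by (simp add: one_pCons)
  then show ?thesis
    by (simp add: u_var_def)
qed

lemma ln_argument_nth_0:
  "(fps_const (1 - u_var) / (1 - fps_const u_var * exp_fps (fps_X * fps_const (1 - u_var)))) $ 0 = 1"
  using u_var_neq_1 by (simp add: fps_divide_unit exp_fps_def)

end

theory Submission
  imports Defs
begin

text \<open>
  Let \<open>P\<^sub>n(x)\<close> be the sum of \<open>x\<^sup>i y\<^sup>j u\<^sup>k\<close> over the tableaux of length \<open>n\<close>.  Appending a south step
  to the border adds an empty row, which contributes the factor \<open>x u\<close>.  Appending a west step adds
  a new leftmost column, whose arrows lie in free rows only; the free rows carrying a left arrow
  cease to be free, and at most one up arrow occurs, namely as the topmost arrow.  Summing over the
  fillings of this column replaces \<open>x\<^sup>i\<close> by \<open>(x + y) (x + 1)\<^sup>i - x\<^sup>i\<^sup>+\<^sup>1\<close>.  Hence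
  \<open>P\<^sub>n\<^sub>+\<^sub>1(x) = x (u - 1) P\<^sub>n(x) + (x + y) P\<^sub>n(x + 1)\<close>.  The closed form \<open>A(x)\<close> satisfies the
  corresponding differential equation because \<open>A(x + 1) = A(x) g\<close>, where \<open>g\<close> is the argument of the
  logarithm, and \<open>(ln g)' = g - (1 - u)\<close>.  Because of the shift \<open>x + 1\<close>, the
  coefficients are compared for all field elements \<open>x\<close> at once, by induction on \<open>n\<close>.
\<close>

section \<open>Borders extended by one step\<close>

lemma rows_snoc:
  "rows (s @ [South]) = insert (length s) (rows s)"
  "rows (s @ [West]) = rows s"
  by (auto simp: rows_def nth_append less_Suc_eq)

lemma columns_snoc:
  "columns (s @ [South]) = columns s"
  "columns (s @ [West]) = insert (length s) (columns s)"
  by (auto simp: columns_def nth_append less_Suc_eq)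

lemma rows_less_length: "p \<in> rows s \<Longrightarrow> p < length s"
  by (simp add: rows_def)

lemma columns_less_length: "q \<in> columns s \<Longrightarrow> q < length s"
  by (simp add: columns_def)

lemma finite_rows: "finite (rows s)"
  by (simp add: rows_def)

lemma finite_columns: "finite (columns s)"
  by (simp add: columns_def)

lemma cells_snoc:
  "cells (s @ [South]) = cells s"
  "cells (s @ [West]) = cells s \<union> rows s \<times> {length s}"
  by (auto simp: cells_def rows_snoc columns_snoc dest: rows_less_length columns_less_length)

lemma cells_less_length: "(p, q) \<in> cells s \<Longrightarrow> q < length s"
  by (simp add: cells_def columns_less_length)

section \<open>Fillings of a single column\<close>

definition column_fillings :: "nat set \<Rightarrow> (nat \<Rightarrow> arrow option) set" where
  "column_fillings R =
     {c. dom c \<subseteq> R \<and> (\<forall>p p'. c p = Some Up_Arrow \<and> p' < p \<longrightarrow> c p' = None)}"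

text \<open>With \<open>R\<close> the free rows of a tableau, this is the part of the extended
  tableau's weight that depends on the new column: a factor \<open>a\<close> for each row that stays
  free, and \<open>y\<close> if the new column is free.\<close>

definition column_weight :: "'a \<Rightarrow> 'a \<Rightarrow> nat set \<Rightarrow> (nat \<Rightarrow> arrow option) \<Rightarrow> 'a :: comm_ring_1" where
  "column_weight a y R c = a ^ card {p \<in> R. c p \<noteq> Some Left_Arrow} *
     (if Some Up_Arrow \<in> range c then 1 else y)"

text \<open>The row \<open>b\<close> lies below all of \<open>R\<close>, so the split is by the
  content of its cell. An empty cell or a left arrow does not restrict the cells above; an up arrow
  forces all of them to be empty, which leaves one filling.\<close>

lemma column_fillings_insert:
  assumes "\<And>p. p \<in> R \<Longrightarrow> p < b"
  shows "column_fillings (insert b R) = column_fillings R \<union>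
    (\<lambda>c. c(b \<mapsto> Left_Arrow)) ` column_fillings R \<union> {[b \<mapsto> Up_Arrow]}"
proof (intro equalityI subsetI)
  fix c assume c: "c \<in> column_fillings (insert b R)"
  have D: "c p = None" if "p \<noteq> b" "p \<notin> R" for p
    using c that by (auto simp: column_fillings_def)
  have U: "c p' = None" if "c p = Some Up_Arrow" "p' < p" for p p'
    using c that by (auto simp: column_fillings_def)
  consider "c b = None" | "c b = Some Left_Arrow" | "c b = Some Up_Arrow"
    by (metis arrow.exhaust option.exhaust)
  then show "c \<in> column_fillings R \<union>
    (\<lambda>c. c(b \<mapsto> Left_Arrow)) ` column_fillings R \<union> {[b \<mapsto> Up_Arrow]}"
  proof cases
    case 1
    then show ?thesis using c by (auto simp: column_fillings_def)
  next
    case 2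
    then have "c(b := None) \<in> column_fillings R"
      using c by (auto simp: column_fillings_def)
    with 2 have "c \<in> (\<lambda>c. c(b \<mapsto> Left_Arrow)) ` column_fillings R"
      by (intro image_eqI[where x = "c(b := None)"]) auto
    then show ?thesis by simp
  next
    case 3
    have "c = [b \<mapsto> Up_Arrow]"
    proof
      fix p show "c p = [b \<mapsto> Up_Arrow] p"
        using 3 D[of p] U[OF 3, of p] assms[of p] by (cases "p = b"; cases "p \<in> R") auto
    qed
    then show ?thesis by simp
  qed
next
  fix c assume "c \<in> column_fillings R \<union>
    (\<lambda>c. c(b \<mapsto> Left_Arrow)) ` column_fillings R \<union> {[b \<mapsto> Up_Arrow]}"
  then consider "c \<in> column_fillings R"
    | d where "d \<in> column_fillings R" "c = d(b \<mapsto> Left_Arrow)" | "c = [b \<mapsto> Up_Arrow]"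
    by blast
  then show "c \<in> column_fillings (insert b R)"
  proof cases
    case 2
    \<comment> \<open>Every up arrow of \<open>d\<close> lies above row \<open>b\<close>, so the
      left arrow placed in \<open>b\<close> is never above an up arrow.\<close>
    have "p < b" if "d p = Some Up_Arrow" for p
      using that 2 assms by (auto simp: column_fillings_def)
    with 2 show ?thesis
      by (fastforce simp: column_fillings_def)
  qed (auto simp: column_fillings_def)
qed

lemma column_fillings_empty: "column_fillings {} = {Map.empty}"
  by (auto simp: column_fillings_def)

lemma finite_column_fillings: "finite R \<Longrightarrow> finite (column_fillings R)"
  by (induction R rule: finite_linorder_max_induct)
    (simp_all add: column_fillings_empty column_fillings_insert)

text \<open>Induction adds a new bottom row. Its cell contributes a factor \<open>a\<close> when
  empty (the row stays free) and a factor \<open>1\<close> with a left arrow. The only filling with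
  an up arrow there keeps all rows free and has weight \<open>a ^ Suc (card R)\<close>. So the sum
  is multiplied by \<open>a + 1\<close> and increased by that power.\<close>

lemma sum_column_weight:
  fixes a y :: "'a :: comm_ring_1"
  assumes "finite R"
  shows "(\<Sum>c\<in>column_fillings R. column_weight a y R c) =
    (a + y) * (a + 1) ^ card R - a ^ Suc (card R)"
  using assms
proof (induction R rule: finite_linorder_max_induct)
  case empty
  then show ?case
    by (simp add: column_fillings_empty column_weight_def)
next
  case (insert b R)
  let ?C = "column_fillings R" and ?f = "\<lambda>c. c(b \<mapsto> Left_Arrow)"
    and ?w = "column_weight a y (insert b R)"
  have b: "b \<notin> R" using insert by auto
  have N: "c b = None" if "c \<in> ?C" for c
    using that b by (auto simp: column_fillings_def)
  have fin: "finite ?C" using insert by (simp add: finite_column_fillings)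
  have inj: "inj_on ?f ?C"
    by (rule inj_onI) (metis N fun_upd_triv fun_upd_upd)
  have disj: "?C \<inter> ?f ` ?C = {}" "(?C \<union> ?f ` ?C) \<inter> {[b \<mapsto> Up_Arrow]} = {}"
    by (auto dest!: N dest: fun_cong[where x = b])
  have wN: "?w c = a * column_weight a y R c" if "c \<in> ?C" for c
  proof -
    have "{p \<in> insert b R. c p \<noteq> Some Left_Arrow} = insert b {p \<in> R. c p \<noteq> Some Left_Arrow}"
      using N[OF that] by auto
    then show ?thesis
      using insert b by (simp add: column_weight_def)
  qed
  have wL: "?w (?f c) = column_weight a y R c" if "c \<in> ?C" for c
  proof -
    have "{p \<in> insert b R. ?f c p \<noteq> Some Left_Arrow} = {p \<in> R. c p \<noteq> Some Left_Arrow}"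
      using b by auto
    moreover have "Some Up_Arrow \<in> range (?f c) \<longleftrightarrow> Some Up_Arrow \<in> range c"
      using N[OF that] by (auto simp: image_iff) (metis option.distinct(1))+
    ultimately show ?thesis
      by (simp add: column_weight_def)
  qed
  have wU: "?w [b \<mapsto> Up_Arrow] = a ^ Suc (card R)"
  proof -
    have "{p \<in> insert b R. [b \<mapsto> Up_Arrow] p \<noteq> Some Left_Arrow} = insert b R"
      by auto
    moreover have "Some Up_Arrow \<in> range [b \<mapsto> Up_Arrow]"
      by (auto simp: image_iff intro: exI[of _ b])
    ultimately show ?thesis
      using insert b by (simp add: column_weight_def)
  qed
  have "sum ?w (column_fillings (insert b R)) = sum ?w ?C + sum ?w (?f ` ?C) + ?w [b \<mapsto> Up_Arrow]"
    using insert fin disj by (simp add: column_fillings_insert sum.union_disjoint)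
  also have "\<dots> = (a + 1) * (\<Sum>c\<in>?C. column_weight a y R c) + a ^ Suc (card R)"
    by (simp add: sum.reindex[OF inj] wN wL wU sum_distrib_left[symmetric] algebra_simps
        cong: sum.cong)
  also have "\<dots> = (a + y) * (a + 1) ^ card (insert b R) - a ^ Suc (card (insert b R))"
    unfolding insert.IH using insert.hyps b by (simp add: algebra_simps)
  finally show ?case .
qed

section \<open>Adding and removing the leftmost column of a tableau\<close>

definition add_column ::
    "nat \<Rightarrow> (nat \<times> nat \<Rightarrow> arrow option) \<Rightarrow> (nat \<Rightarrow> arrow option) \<Rightarrow> nat \<times> nat \<Rightarrow> arrow option" where
  "add_column n T c = (\<lambda>(p, q). if q = n then c p else T (p, q))"

lemma add_column_apply: "add_column n T c (p, q) = (if q = n then c p else T (p, q))"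
  by (simp add: add_column_def)

lemma alternative_tableau_None:
  "alternative_tableau s T \<Longrightarrow> (p, q) \<notin> cells s \<Longrightarrow> T (p, q) = None"
  unfolding alternative_tableau_def by (metis domIff subsetD)

lemma alternative_tableau_None_length:
  "alternative_tableau s T \<Longrightarrow> T (p, length s) = None"
  by (rule alternative_tableau_None) (auto dest: cells_less_length)

lemma alternative_tableau_Left_Arrow:
  "alternative_tableau s T \<Longrightarrow> T (p, q) = Some Left_Arrow \<Longrightarrow> (p, q') \<in> cells s \<Longrightarrow> q < q' \<Longrightarrow>
    T (p, q') = None"
  unfolding alternative_tableau_def by metis

lemma alternative_tableau_Up_Arrow:
  "alternative_tableau s T \<Longrightarrow> T (p, q) = Some Up_Arrow \<Longrightarrow> (p', q) \<in> cells s \<Longrightarrow> p' < p \<Longrightarrow>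
    T (p', q) = None"
  unfolding alternative_tableau_def by metis

lemma alternative_tableau_snoc_South:
  "alternative_tableau (s @ [South]) T \<longleftrightarrow> alternative_tableau s T"
  by (simp add: alternative_tableau_def cells_snoc)

text \<open>Cells of the new column lie to the left of all others, so the row condition only asks
  that its arrows avoid rows that already have a left arrow; this is why the filling is confined to
  free rows. The column condition is built into \<open>column_fillings\<close>.\<close>

lemma alternative_tableau_add_column:
  assumes T: "alternative_tableau s T" and c: "c \<in> column_fillings (free_rows s T)"
  shows "alternative_tableau (s @ [West]) (add_column (length s) T c)"
proof -
  have R: "p \<in> rows s \<and> T (p, q) \<noteq> Some Left_Arrow" if "c p = Some v" for p q v
    using c that by (auto simp: column_fillings_def free_rows_def)
  have D: "(p, q) \<in> cells s" if "T (p, q) = Some v" for p q v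
    using alternative_tableau_None[OF T, of p q] that by auto
  show ?thesis
    unfolding alternative_tableau_def cells_snoc add_column_apply
  proof (intro conjI allI impI subsetI)
    fix t assume "t \<in> dom (add_column (length s) T c)"
    then show "t \<in> cells s \<union> rows s \<times> {length s}"
      using R D by (cases t) (auto simp: add_column_apply split: if_splits)
  next
    fix p q q'
    assume *: "(if q = length s then c p else T (p, q)) = Some Left_Arrow \<and>
      (p, q') \<in> cells s \<union> rows s \<times> {length s} \<and> q < q'"
    \<comment> \<open>No cell lies to the left of the new column, so the left arrow in question
      belongs to \<open>T\<close>.\<close>
    then have q: "q < length s"
      using cells_less_length[of p q' s] by auto
    show "(if q' = length s then c p else T (p, q')) = None"
    proof (cases "q' = length s")
      case True
      then show ?thesis using * q R[of p _ q] by (cases "c p") auto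
    next
      case False
      with * q show ?thesis
        using alternative_tableau_Left_Arrow[OF T, of p q q'] by auto
    qed
  next
    fix p p' q
    assume *: "(if q = length s then c p else T (p, q)) = Some Up_Arrow \<and>
      (p', q) \<in> cells s \<union> rows s \<times> {length s} \<and> p' < p"
    show "(if q = length s then c p' else T (p', q)) = None"
    proof (cases "q = length s")
      case True
      then show ?thesis using * c by (auto simp: column_fillings_def)
    next
      case False
      with * show ?thesis
        using alternative_tableau_Up_Arrow[OF T, of p q p'] by auto
    qed
  qed
qed

text \<open>Converse of the extension: the leftmost column is cut off and read as a filling. Its
  arrows sit in free rows of the remainder, because a left arrow of the remainder in the same row
  would lie to their right and force their cell to be empty.\<close>

lemma alternative_tableau_snoc_West_cases:
  assumes "alternative_tableau (s @ [West]) T'"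
  obtains T c where "alternative_tableau s T" "c \<in> column_fillings (free_rows s T)"
    "T' = add_column (length s) T c"
proof
  \<comment> \<open>Overwriting the last column with the empty filling erases it.\<close>
  let ?T = "add_column (length s) T' Map.empty" and ?c = "\<lambda>p. T' (p, length s)"
  have D: "(p, q) \<in> cells s \<or> p \<in> rows s \<and> q = length s" if "T' (p, q) = Some v" for p q v
    using alternative_tableau_None[OF assms, of p q] that by (auto simp: cells_snoc)
  have L: "T' (p, q') = None"
    if "T' (p, q) = Some Left_Arrow" "(p, q') \<in> cells s \<or> p \<in> rows s \<and> q' = length s" "q < q'" for p q q'
    using alternative_tableau_Left_Arrow[OF assms that(1) _ that(3)] that(2) by (auto simp: cells_snoc)
  have U: "T' (p', q) = None"
    if "T' (p, q) = Some Up_Arrow" "(p', q) \<in> cells s \<or> p' \<in> rows s \<and> q = length s" "p' < p" for p p' q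
    using alternative_tableau_Up_Arrow[OF assms that(1) _ that(3)] that(2) by (auto simp: cells_snoc)
  show "alternative_tableau s ?T"
    unfolding alternative_tableau_def
  proof (intro conjI allI impI subsetI)
    fix t assume "t \<in> dom ?T"
    then show "t \<in> cells s"
      using D[of "fst t" "snd t"] by (cases t) (auto simp: add_column_apply split: if_splits)
  next
    fix p q q'
    assume "?T (p, q) = Some Left_Arrow \<and> (p, q') \<in> cells s \<and> q < q'"
    then show "?T (p, q') = None"
      using L[of p q q'] by (simp add: add_column_apply split: if_splits)
  next
    fix p p' q
    assume "?T (p, q) = Some Up_Arrow \<and> (p', q) \<in> cells s \<and> p' < p"
    then show "?T (p', q) = None"
      using U[of p q p'] by (simp add: add_column_apply split: if_splits)
  qed
  show "T' = add_column (length s) ?T ?c"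
    by (auto simp: add_column_def)
  show "?c \<in> column_fillings (free_rows s ?T)"
    unfolding column_fillings_def
  proof (intro CollectI conjI allI impI subsetI)
    fix p assume "p \<in> dom ?c"
    then have p: "p \<in> rows s" and N: "T' (p, length s) \<noteq> None"
      using D[of p "length s"] cells_less_length[of p "length s" s] by auto
    have "T' (p, q) \<noteq> Some Left_Arrow" if "q \<noteq> length s" for q
      using L[of p q "length s"] D[of p q Left_Arrow] cells_less_length[of p q s] p N that by auto
    then show "p \<in> free_rows s ?T"
      using p by (auto simp: free_rows_def add_column_apply)
  next
    fix p p' assume "T' (p, length s) = Some Up_Arrow \<and> p' < p"
    then show "T' (p', length s) = None"
      using U[of p "length s" p'] D[of p' "length s"] cells_less_length[of p' "length s" s]
      by (cases "T' (p', length s)") auto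
  qed
qed

section \<open>Free rows and free columns of an extended tableau\<close>

lemma free_rows_subset_rows: "free_rows s T \<subseteq> rows s"
  by (auto simp: free_rows_def)

lemma free_columns_subset_columns: "free_columns s T \<subseteq> columns s"
  by (auto simp: free_columns_def)

lemma finite_free_rows: "finite (free_rows s T)"
  by (rule finite_subset[OF free_rows_subset_rows finite_rows])

lemma finite_free_columns: "finite (free_columns s T)"
  by (rule finite_subset[OF free_columns_subset_columns finite_columns])

lemma length_notin:
  "length s \<notin> rows s" "length s \<notin> free_rows s T" "length s \<notin> free_columns s T"
  by (simp_all add: rows_def columns_def free_rows_def free_columns_def)

lemma free_rows_snoc_South:
  assumes "alternative_tableau s T"
  shows "free_rows (s @ [South]) T = insert (length s) (free_rows s T)"
proof -
  have "T (length s, q) = None" for q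
    using alternative_tableau_None[OF assms] rows_less_length[of "length s" s]
    by (auto simp: cells_def)
  then show ?thesis
    by (auto simp: free_rows_def rows_snoc)
qed

lemma free_columns_snoc_South: "free_columns (s @ [South]) T = free_columns s T"
  by (simp add: free_columns_def columns_snoc)

lemma free_rows_add_column:
  assumes "alternative_tableau s T"
  shows "free_rows (s @ [West]) (add_column (length s) T c) =
    {p \<in> free_rows s T. c p \<noteq> Some Left_Arrow}"
proof -
  \<comment> \<open>\<open>T\<close> has no entry in the column being overwritten, so no left arrow
    is lost.\<close>
  have "T (p, length s) = None" for p
    using assms by (rule alternative_tableau_None_length)
  then have "(\<forall>q. add_column (length s) T c (p, q) \<noteq> Some Left_Arrow) \<longleftrightarrow>
      (\<forall>q. T (p, q) \<noteq> Some Left_Arrow) \<and> c p \<noteq> Some Left_Arrow" for p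
    unfolding add_column_apply by (metis option.distinct(1))
  then show ?thesis
    unfolding free_rows_def rows_snoc by auto
qed

lemma free_columns_add_column:
  "free_columns (s @ [West]) (add_column (length s) T c) =
    (if Some Up_Arrow \<in> range c then {} else {length s}) \<union> free_columns s T"
proof -
  let ?T = "add_column (length s) T c"
  have "(\<forall>p. ?T (p, length s) \<noteq> Some Up_Arrow) \<longleftrightarrow> Some Up_Arrow \<notin> range c"
    unfolding image_iff by (metis UNIV_I add_column_apply)
  moreover have "(\<forall>p. ?T (p, q) \<noteq> Some Up_Arrow) \<longleftrightarrow> (\<forall>p. T (p, q) \<noteq> Some Up_Arrow)"
    if "q \<in> columns s" for q
    using columns_less_length[OF that] by (simp add: add_column_apply)
  ultimately show ?thesis
    unfolding free_columns_def columns_snoc by auto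
qed

section \<open>The weighted sum over tableaux of fixed length and its recurrence\<close>

definition tableaux_of_length :: "nat \<Rightarrow> (step list \<times> (nat \<times> nat \<Rightarrow> arrow option)) set" where
  "tableaux_of_length n = {(s, T). length s = n \<and> alternative_tableau s T}"

definition tableau_weight ::
    "'a \<Rightarrow> 'a \<Rightarrow> 'a \<Rightarrow> step list \<times> (nat \<times> nat \<Rightarrow> arrow option) \<Rightarrow> 'a :: comm_ring_1" where
  "tableau_weight u y a = (\<lambda>(s, T).
     a ^ card (free_rows s T) * y ^ card (free_columns s T) * u ^ card (rows s))"

text \<open>The variable marking free rows is an argument \<open>a\<close> from an arbitrary
  commutative ring, since the recurrence also evaluates the sum at \<open>a + 1\<close>.\<close>

definition tableaux_poly :: "'a \<Rightarrow> 'a \<Rightarrow> nat \<Rightarrow> 'a \<Rightarrow> 'a :: comm_ring_1" where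
  "tableaux_poly u y n a = sum (tableau_weight u y a) (tableaux_of_length n)"

lemma card_bounds:
  "card (rows s) \<le> length s" "card (free_rows s T) \<le> length s" "card (free_columns s T) \<le> length s"
proof -
  have "card X \<le> length s" if "X \<subseteq> {..<length s}" for X
    using card_mono[OF _ that] by simp
  then show "card (rows s) \<le> length s" "card (free_rows s T) \<le> length s"
    "card (free_columns s T) \<le> length s"
    by (simp_all add: rows_def columns_def free_rows_def free_columns_def subset_iff)
qed

lemma finite_tableaux_of_length: "finite (tableaux_of_length n)"
proof -
  have "tableaux_of_length n \<subseteq> (\<Union>i\<le>n. \<Union>j\<le>n. \<Union>k\<le>n. tableaux i j n k)"
    using card_bounds by (force simp: tableaux_of_length_def tableaux_def)
  then show ?thesis
    by (rule finite_subset) (simp add: finite_tableaux)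
qed

lemma tableaux_of_length_0: "tableaux_of_length 0 = {([], Map.empty)}"
  by (auto simp: tableaux_of_length_def alternative_tableau_def cells_def rows_def)

text \<open>A nonempty border is split at its last step. A final south step creates a row without
  cells, so the filling is unchanged; a final west step creates a column whose admissible fillings
  depend on the free rows of the smaller tableau, hence the dependent sum.\<close>

lemma tableaux_of_length_Suc:
  "tableaux_of_length (Suc n) =
     (\<lambda>(s, T). (s @ [South], T)) ` tableaux_of_length n \<union>
     (\<lambda>((s, T), c). (s @ [West], add_column n T c)) `
       (SIGMA (s, T) : tableaux_of_length n. column_fillings (free_rows s T))"
    (is "_ = ?S \<union> ?W")
proof (intro equalityI subsetI)
  fix t assume "t \<in> tableaux_of_length (Suc n)"
  then obtain s d T where t: "t = (s @ [d], T)" "length s = n" "alternative_tableau (s @ [d]) T"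
    by (auto simp: tableaux_of_length_def length_Suc_conv_rev)
  show "t \<in> ?S \<union> ?W"
  proof (cases d)
    case South
    then have "(s, T) \<in> tableaux_of_length n"
      using t by (simp add: tableaux_of_length_def alternative_tableau_snoc_South)
    then show ?thesis using t South by force
  next
    case West
    then obtain T' c where "alternative_tableau s T'" "c \<in> column_fillings (free_rows s T')"
      "T = add_column n T' c"
      using t alternative_tableau_snoc_West_cases by metis
    then have "((s, T'), c) \<in> (SIGMA (s, T) : tableaux_of_length n. column_fillings (free_rows s T))"
      "t = (\<lambda>((s, T), c). (s @ [West], add_column n T c)) ((s, T'), c)"
      using t West by (auto simp: tableaux_of_length_def)
    then show ?thesis by blast
  qed
next
  fix t assume "t \<in> ?S \<union> ?W"
  then show "t \<in> tableaux_of_length (Suc n)"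
    by (auto simp: tableaux_of_length_def alternative_tableau_snoc_South
        intro: alternative_tableau_add_column)
qed

lemma tableaux_poly_0: "tableaux_poly u y 0 a = 1"
  by (simp add: tableaux_poly_def tableaux_of_length_0 tableau_weight_def free_rows_def
      free_columns_def rows_def columns_def)

lemma tableaux_poly_Suc:
  fixes u y a :: "'a :: comm_ring_1"
  shows "tableaux_poly u y (Suc n) a =
    a * (u - 1) * tableaux_poly u y n a + (a + y) * tableaux_poly u y n (a + 1)"
proof -
  let ?X = "tableaux_of_length n"
  let ?C = "\<lambda>(s, T). column_fillings (free_rows s T)"
  let ?S = "\<lambda>(s :: step list, T :: nat \<times> nat \<Rightarrow> arrow option). (s @ [South], T)"
  let ?W = "\<lambda>((s, T), c). (s @ [West], add_column n T c)"
  let ?w = "tableau_weight u y a"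
  have injS: "inj_on ?S ?X"
    by (auto simp: inj_on_def)
  have injW: "inj_on ?W (Sigma ?X ?C)"
  proof (rule inj_onI, clarsimp)
    fix s T c T' c'
    assume *: "(s, T) \<in> ?X" "(s, T') \<in> ?X" "add_column n T c = add_column n T' c'"
    have eq: "add_column n T c (p, q) = add_column n T' c' (p, q)" for p q
      using * by simp
    \<comment> \<open>Entries outside column \<open>n\<close> survive in the extended map, and
      inside it both tableaux are empty, so the tableau and the filling can be recovered.\<close>
    have "T (p, n) = None" "T' (p, n) = None" for p
      using * alternative_tableau_None_length[of s] by (auto simp: tableaux_of_length_def)
    then have "T (p, q) = T' (p, q)" for p q
      using eq[of p q] by (cases "q = n") (auto simp: add_column_apply)
    moreover have "c p = c' p" for p
      using eq[of p n] by (simp add: add_column_apply)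
    ultimately show "T = T' \<and> c = c'"
      by auto
  qed
  have finC: "finite (?C t)" for t
    by (cases t) (simp add: finite_column_fillings finite_free_rows)
  have wS: "?w (?S t) = a * u * ?w t" if "t \<in> ?X" for t
  proof -
    obtain s T where t: "t = (s, T)" "length s = n" "alternative_tableau s T"
      using \<open>t \<in> ?X\<close> by (auto simp: tableaux_of_length_def)
    then show ?thesis
      using length_notin(1)[of s] length_notin(2)[of s T]
      by (simp add: tableau_weight_def free_rows_snoc_South free_columns_snoc_South
          rows_snoc finite_rows finite_free_rows)
  qed
  have wW: "(\<Sum>c\<in>?C t. ?w (?W (t, c))) = (a + y) * tableau_weight u y (a + 1) t - a * ?w t"
    if "t \<in> ?X" for t
  proof -
    obtain s T where t: "t = (s, T)" "length s = n" "alternative_tableau s T"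
      using \<open>t \<in> ?X\<close> by (auto simp: tableaux_of_length_def)
    let ?R = "free_rows s T"
    \<comment> \<open>The factor independent of the filling: a west step adds no row and leaves the
      status of the old columns unchanged.\<close>
    let ?z = "y ^ card (free_columns s T) * u ^ card (rows s)"
    have "?w (?W (t, c)) = ?z * column_weight a y ?R c" for c
      using t free_rows_add_column[OF t(3), of c] free_columns_add_column[of s T c]
        length_notin(3)[of s T]
      by (simp add: tableau_weight_def column_weight_def rows_snoc finite_free_columns)
    then have "(\<Sum>c\<in>?C t. ?w (?W (t, c))) = ?z * (\<Sum>c\<in>column_fillings ?R. column_weight a y ?R c)"
      using t by (simp add: sum_distrib_left)
    \<comment> \<open>For \<open>r\<close> free rows the column sum is
      \<open>(a + y) * (a + 1) ^ r - a ^ Suc r\<close>; the power of \<open>a + 1\<close> is what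
      turns the weight at \<open>a\<close> into the weight at \<open>a + 1\<close>.\<close>
    also have "\<dots> = (a + y) * tableau_weight u y (a + 1) t - a * ?w t"
      using t by (simp add: sum_column_weight finite_free_rows tableau_weight_def algebra_simps)
    finally show ?thesis .
  qed
  \<comment> \<open>The two images are disjoint because the borders differ in their last
    step.\<close>
  have "tableaux_poly u y (Suc n) a = sum ?w (?S ` ?X) + sum ?w (?W ` Sigma ?X ?C)"
    unfolding tableaux_poly_def tableaux_of_length_Suc
    using finite_tableaux_of_length finC
    by (intro sum.union_disjoint finite_imageI finite_SigmaI) auto
  also have "sum ?w (?S ` ?X) = (\<Sum>t\<in>?X. a * u * ?w t)"
    by (simp add: sum.reindex[OF injS] wS del: split_paired_All cong: sum.cong)
  also have "sum ?w (?W ` Sigma ?X ?C) = (\<Sum>t\<in>?X. \<Sum>c\<in>?C t. ?w (?W (t, c)))"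
    using finite_tableaux_of_length[of n] finC
    by (subst sum.reindex[OF injW], subst sum.Sigma) (auto simp: comp_def intro!: sum.cong)
  also have "\<dots> = (\<Sum>t\<in>?X. (a + y) * tableau_weight u y (a + 1) t - a * ?w t)"
    by (intro sum.cong refl wW)
  finally show ?thesis
    unfolding sum_subtractf sum_distrib_left[symmetric] tableaux_poly_def[symmetric]
    by (simp add: algebra_simps)
qed

text \<open>Tableaux are grouped by their numbers of rows, free rows and free columns, each at most
  \<open>n\<close>; the weight is constant on every group. This links the recurrence to the
  coefficients of \<open>tableaux_gf\<close>.\<close>

lemma tableaux_poly_eq_sum_tableaux_count:
  fixes u y a :: "'a :: comm_ring_1"
  shows "tableaux_poly u y n a =
    (\<Sum>k\<le>n. \<Sum>i\<le>n. \<Sum>j\<le>n. of_nat (tableaux_count i j n k) * a ^ i * y ^ j * u ^ k)"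
proof -
  let ?X = "tableaux_of_length n" and ?w = "tableau_weight u y a"
  let ?g = "\<lambda>(s, T). (card (rows s), card (free_rows s T), card (free_columns s T))"
  let ?I = "{..n} \<times> {..n} \<times> {..n}"
  have group: "sum ?w {t \<in> ?X. ?g t = (k, i, j)} =
      of_nat (tableaux_count i j n k) * a ^ i * y ^ j * u ^ k" for k i j
  proof -
    have "{t \<in> ?X. ?g t = (k, i, j)} = tableaux i j n k"
      by (auto simp: tableaux_of_length_def tableaux_def)
    moreover have "?w t = a ^ i * y ^ j * u ^ k" if "t \<in> tableaux i j n k" for t
      using that by (auto simp: tableaux_def tableau_weight_def)
    ultimately show ?thesis
      by (simp add: tableaux_count_def mult.assoc)
  qed
  have "?g ` ?X \<subseteq> ?I"
    by (auto simp: tableaux_of_length_def card_bounds)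
  then have "tableaux_poly u y n a = (\<Sum>b\<in>?I. sum ?w {t \<in> ?X. ?g t = b})"
    unfolding tableaux_poly_def
    by (intro sum.group[symmetric] finite_tableaux_of_length) auto
  also have "\<dots> = (\<Sum>(k, i, j)\<in>?I. of_nat (tableaux_count i j n k) * a ^ i * y ^ j * u ^ k)"
  proof (rule sum.cong[OF refl])
    fix b
    show "sum ?w {t \<in> ?X. ?g t = b} =
        (case b of (k, i, j) \<Rightarrow> of_nat (tableaux_count i j n k) * a ^ i * y ^ j * u ^ k)"
      by (cases b rule: prod_cases3) (simp only: group prod.case)
  qed
  finally show ?thesis
    by (simp add: sum.cartesian_product)
qed

section \<open>Exponential, logarithm and linear differential equations for formal power
  series\<close>

lemma exp_fps_nth_0: "exp_fps F $ 0 = 1"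
  by (simp add: exp_fps_def)

lemma ln_fps_nth_0: "ln_fps G $ 0 = 0"
  by (simp add: ln_fps_def)

lemma fps_deriv_exp_fps:
  assumes "F $ 0 = 0"
  shows "fps_deriv (exp_fps F) = fps_deriv F * exp_fps F"
  using assms by (simp add: exp_fps_def fps_compose_deriv mult.commute)

lemma fps_deriv_ln_fps:
  fixes G :: "'a :: field_char_0 fps"
  assumes "G $ 0 = 1"
  shows "fps_deriv (ln_fps G) = fps_deriv G * inverse G"
proof -
  have "fps_deriv (ln_fps G) = (inverse (1 + fps_X) oo (G - 1)) * fps_deriv G"
    using assms by (simp add: ln_fps_def fps_compose_deriv fps_ln_deriv)
  also have "inverse (1 + fps_X) oo (G - 1) = inverse G"
    using assms by (simp add: fps_inverse_compose fps_compose_add_distrib)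
  finally show ?thesis
    by (simp add: mult.commute)
qed

text \<open>The quotient \<open>A * inverse B\<close> has derivative \<open>0\<close>, so it is
  constant, and its constant term is \<open>1\<close>.\<close>

lemma fps_linear_ode_unique:
  fixes A B F :: "'a :: field_char_0 fps"
  assumes "fps_deriv A = F * A" "fps_deriv B = F * B" "A $ 0 = B $ 0" "B $ 0 \<noteq> 0"
  shows "A = B"
proof -
  have B: "inverse B * B = 1"
    using assms(4) by (rule inverse_mult_eq_1)
  have "fps_deriv (A * inverse B) =
      F * A * inverse B - A * (F * (inverse B * B)) * inverse B"
    unfolding fps_deriv_mult fps_inverse_deriv[OF assms(4)] assms(1,2)
    by (simp add: power2_eq_square algebra_simps)
  also have "\<dots> = 0"
    unfolding B by (simp add: mult_ac)
  finally have "A * inverse B = fps_const ((A * inverse B) $ 0)"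
    by (simp only: fps_deriv_eq_0_iff)
  also have "\<dots> = 1"
    using assms by simp
  finally have "A * (inverse B * B) = B"
    by (metis mult.assoc mult_1)
  then show ?thesis
    by (simp add: B)
qed

text \<open>Both sides solve \<open>Y' = (F' + H') * Y\<close> with constant term
  \<open>1\<close>.\<close>

lemma exp_fps_add:
  assumes "F $ 0 = 0" "H $ 0 = 0"
  shows "exp_fps (F + H) = exp_fps F * exp_fps H"
  by (rule fps_linear_ode_unique[where F = "fps_deriv F + fps_deriv H"])
    (use assms in \<open>simp_all add: fps_deriv_exp_fps exp_fps_nth_0 algebra_simps\<close>)

text \<open>Both sides have logarithmic derivative \<open>G' * inverse G\<close> and constant term
  \<open>1\<close>.\<close>

lemma exp_fps_ln_fps:
  fixes G :: "'a :: field_char_0 fps"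
  assumes "G $ 0 = 1"
  shows "exp_fps (ln_fps G) = G"
proof (rule fps_linear_ode_unique[where F = "fps_deriv G * inverse G"])
  have "inverse G * G = 1"
    using assms by (simp add: inverse_mult_eq_1)
  then show "fps_deriv G = fps_deriv G * inverse G * G"
    by (simp add: mult.assoc)
qed (use assms in \<open>simp_all add: exp_fps_nth_0 ln_fps_nth_0 fps_deriv_exp_fps fps_deriv_ln_fps\<close>)

section \<open>The Eulerian generating function inside the logarithm, and the closed form\<close>

definition log_argument :: "'a \<Rightarrow> 'a :: field_char_0 fps" where
  "log_argument u = fps_const (1 - u) / (1 - fps_const u * exp_fps (fps_X * fps_const (1 - u)))"

lemma log_argument_nth_0: "u \<noteq> 1 \<Longrightarrow> log_argument u $ 0 = 1"
  by (simp add: log_argument_def fps_divide_unit exp_fps_nth_0)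

text \<open>Differentiating the relation \<open>G * (1 - w) = v\<close>, with \<open>v\<close>
  constant and \<open>w' = v * w\<close>, yields the Riccati equation
  \<open>G' = G * (G - v)\<close>; division by \<open>G\<close> gives the claim.\<close>

lemma fps_deriv_ln_log_argument:
  fixes u :: "'a :: field_char_0"
  assumes "u \<noteq> 1"
  shows "fps_deriv (ln_fps (log_argument u)) = log_argument u - fps_const (1 - u)"
proof -
  define v where "v = fps_const (1 - u)"
  define w where "w = fps_const u * exp_fps (fps_X * v)"
  define G where "G = log_argument u"
  have w0: "(1 - w) $ 0 \<noteq> 0"
    using assms by (simp add: w_def exp_fps_nth_0)
  have G0: "G $ 0 = 1"
    using assms by (simp add: G_def log_argument_nth_0)
  have G: "G * (1 - w) = v"
    using w0 inverse_mult_eq_1[OF w0]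
    by (simp add: G_def log_argument_def fps_divide_unit mult.assoc flip: v_def w_def)
  have w': "fps_deriv w = v * w"
    by (simp add: w_def v_def fps_deriv_exp_fps mult_ac)
  have "fps_deriv (G * (1 - w)) = 0"
    unfolding G by (simp add: v_def)
  then have "fps_deriv G * (1 - w) = G * (v * w)"
    by (simp add: w' algebra_simps)
  also have "\<dots> = G * (v - v * (1 - w))"
    by (simp add: algebra_simps)
  \<comment> \<open>Only the first \<open>v\<close> is replaced by \<open>G * (1 - w)\<close>, which
    exposes the common factor \<open>1 - w\<close>.\<close>
  also have "\<dots> = G * (G - v) * (1 - w)"
    by (subst (1) G[symmetric]) (simp add: algebra_simps)
  \<comment> \<open>The factor \<open>1 - w\<close> can be cancelled: its constant term
    \<open>1 - u\<close> is nonzero.\<close>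
  finally have "fps_deriv G = G * (G - v)"
    using w0 by (metis fps_zero_nth mult_right_cancel)
  then have "fps_deriv G * inverse G = (inverse G * G) * (G - v)"
    by (simp add: mult_ac)
  then show ?thesis
    using G0 inverse_mult_eq_1[of G]
    by (simp add: fps_deriv_ln_fps flip: G_def v_def)
qed

definition closed_form :: "'a \<Rightarrow> 'a \<Rightarrow> 'a \<Rightarrow> 'a :: field_char_0 fps" where
  "closed_form u y a = exp_fps (fps_X * fps_const (y * (1 - u)) +
     fps_const (a + y) * ln_fps (log_argument u))"

lemma closed_form_nth_0: "closed_form u y a $ 0 = 1"
  by (simp add: closed_form_def exp_fps_nth_0)

text \<open>Raising \<open>a\<close> by one adds one copy of the logarithm to the exponent, and its
  exponential is \<open>log_argument u\<close>.\<close>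

lemma closed_form_plus_1:
  assumes "u \<noteq> 1"
  shows "closed_form u y (a + 1) = closed_form u y a * log_argument u"
proof -
  let ?L = "ln_fps (log_argument u)"
  have "closed_form u y (a + 1) =
      exp_fps ((fps_X * fps_const (y * (1 - u)) + fps_const (a + y) * ?L) + ?L)"
    by (simp add: closed_form_def algebra_simps flip: fps_const_add)
  also have "\<dots> = closed_form u y a * exp_fps ?L"
    by (subst exp_fps_add) (simp_all add: closed_form_def ln_fps_nth_0)
  finally show ?thesis
    using assms by (simp add: exp_fps_ln_fps log_argument_nth_0)
qed

text \<open>The exponent has derivative \<open>y * (1 - u) + (a + y) * (g - (1 - u)) = a * (u - 1) +
  (a + y) * g\<close>, where \<open>g\<close> is \<open>log_argument u\<close>, and multiplication
  by \<open>g\<close> is the shift to \<open>a + 1\<close>. This is the recurrence of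
  \<open>tableaux_poly_Suc\<close> in terms of series.\<close>

lemma fps_deriv_closed_form:
  fixes u y a :: "'a :: field_char_0"
  assumes "u \<noteq> 1"
  shows "fps_deriv (closed_form u y a) =
    fps_const (a * (u - 1)) * closed_form u y a + fps_const (a + y) * closed_form u y (a + 1)"
proof -
  have "fps_deriv (closed_form u y a) = (fps_const (y * (1 - u)) +
      fps_const (a + y) * (log_argument u - fps_const (1 - u))) * closed_form u y a"
    using assms by (simp add: closed_form_def fps_deriv_exp_fps ln_fps_nth_0 fps_deriv_ln_log_argument)
  also have "fps_const (y * (1 - u)) + fps_const (a + y) * (log_argument u - fps_const (1 - u)) =
      (fps_const (y * (1 - u) - (a + y) * (1 - u))) + fps_const (a + y) * log_argument u"
    by (simp only: right_diff_distrib fps_const_mult fps_const_sub[symmetric])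
      (simp add: algebra_simps)
  also have "y * (1 - u) - (a + y) * (1 - u) = a * (u - 1)"
    by (simp add: algebra_simps)
  finally show ?thesis
    unfolding closed_form_plus_1[OF assms] by (simp add: algebra_simps)
qed

lemma closed_form_nth:
  assumes "u \<noteq> 1"
  shows "closed_form u y a $ n = tableaux_poly u y n a / fact n"
\<comment> \<open>The step uses the induction hypothesis at both \<open>a\<close> and
  \<open>a + 1\<close>.\<close>
proof (induction n arbitrary: a)
  case 0
  then show ?case
    by (simp add: closed_form_nth_0 tableaux_poly_0)
next
  case (Suc n)
  have "of_nat (Suc n) * closed_form u y a $ Suc n = fps_deriv (closed_form u y a) $ n"
    by simp
  also have "\<dots> = tableaux_poly u y (Suc n) a / fact n"
    using assms by (simp add: fps_deriv_closed_form Suc.IH tableaux_poly_Suc add_divide_distrib)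
  finally show ?case
    by (simp add: field_simps del: of_nat_Suc)
qed

theorem theorem3p2:
  shows "tableaux_gf =
    exp_fps (fps_X * fps_const (y_var * (1 - u_var)) +
      fps_const (x_var + y_var) *
        ln_fps (fps_const (1 - u_var) /
          (1 - fps_const u_var * exp_fps (fps_X * fps_const (1 - u_var)))))"
proof -
  \<comment> \<open>The coefficient formula holds in every field of characteristic \<open>0\<close>;
    here it is applied to the indeterminates in the field of rational functions.\<close>
  have "tableaux_gf = closed_form u_var y_var x_var"
    by (simp add: fps_eq_iff tableaux_gf_def closed_form_nth[OF u_var_neq_1]
        tableaux_poly_eq_sum_tableaux_count)
  then show ?thesis
    by (simp add: closed_form_def log_argument_def)
qed

end
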